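(* Let $(H;\langle\cdot,\cdot\rangle)$ be an infinite dimensional Hilbert space over $\mathbb{K}$ and $(e_i)_{i\in\mathbb{N}}$ an orthonormal family in $H$. If $\lambda=(\lambda_i)_{i\in\mathbb{N}},\ \mu=(\mu_i)_{i\in\mathbb{N}}\in\ell^2(\mathbb{K})$ with $\lambda\ne0$ and $\mu\neq0$, $r_1,r_2>0$ and $x,y\in H$ are such that $$\left\|x-\sum_{i=1}^\infty\lambda_ie_i\right\|\le r_1,\qquad\left\|y-\sum_{i=1}^\infty\mu_ie_i\right\|\le r_2,$$ then $$\left|\langle x,y\rangle-\sum_{i=1}^\infty\langle x,e_i\rangle\langle e_i,y\rangle\right|\le\frac12r_1r_2\,\frac{\left[\|x\|+\left(\sum_{i=1}^\infty|\langle x,e_i\rangle|^2\right)^{1/2}\right]^{1/2}\left[\|y\|+\left(\sum_{i=1}^\infty|\langle y,e_i\rangle|^2\right)^{1/2}\right]^{1/2}}{\left(\sum_{i=1}^\infty|\lambda_i|^2\right)^{1/4}\left(\sum_{i=1}^\infty|\mu_i|^2\right)^{1/4}}$$ $$\le r_1r_2\,\frac{\|x\|^{1/2}\|y\|^{1/2}}{\left(\sum_{i=1}^\infty|\lambda_i|^2\right)^{1/4}\left(\sum_{i=1}^\infty|\mu_i|^2\right)^{1/4}} .$$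
   Context: $\mathbb{K}$ denotes $\mathbb{R}$ or $\mathbb{C}$. Inner products are linear in the first argument and conjugate-linear in the second, and $\|x\|=\langle x,x\rangle^{1/2}$. A family $(e_i)_{i\in\mathbb{N}}$ is orthonormal if $\langle e_i,e_j\rangle=0$ for $i\ne j$ and $\|e_i\|=1$ for all $i$; it is not assumed to be complete. $\ell^2(\mathbb{K})$ is the space of sequences $(a_i)_{i\in\mathbb{N}}$ in $\mathbb{K}$ with $\sum_{i=1}^\infty|a_i|^2<\infty$; for $\lambda\in\ell^2(\mathbb{K})$ the series $\sum_i\lambda_ie_i$ converges in $H$. *)

theory Defs
  imports "HOL-Analysis.Analysis"
begin

text \<open>
  The scalar field, to be thought of as the real or the complex numbers: a real normed field with a
  conjugation. Both fields are instances, and lemma \<open>rc_field_cases\<close> shows that up to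
  isometric isomorphism there are no others.
\<close>

class rc_field = real_normed_field +
  fixes conjug :: "'a \<Rightarrow> 'a"
  assumes conjug_add: "conjug (x + y) = conjug x + conjug y"
    and conjug_mult: "conjug (x * y) = conjug x * conjug y"
    and conjug_conjug: "conjug (conjug x) = x"
    and mult_conjug_scaleR: "x * conjug x = (norm x)\<^sup>2 *\<^sub>R 1"

lemma mult_conjug: "(x :: 'a::rc_field) * conjug x = of_real ((norm x)\<^sup>2)"
  by (simp only: mult_conjug_scaleR of_real_def)

instantiation real :: rc_field
begin
definition conjug_real :: "real \<Rightarrow> real" where "conjug_real x = x"
instance by standard (simp_all add: conjug_real_def power2_eq_square)
end

instantiation complex :: rc_field
begin
definition conjug_complex :: "complex \<Rightarrow> complex" where "conjug_complex = cnj"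
instance by standard (simp_all add: conjug_complex_def complex_norm_square[symmetric] of_real_def[symmetric])
end

lemma conjug_of_real: "conjug (of_real r :: 'a::rc_field) = of_real r"
proof (cases "r = 0")
  case True
  then show ?thesis using conjug_add[of "0::'a" 0] by simp
next
  case False
  have "(of_real r :: 'a) * conjug (of_real r) = of_real r * of_real r"
    unfolding mult_conjug by (simp add: power2_eq_square)
  with False show ?thesis by simp
qed

lemma conjug_minus: "conjug (- x :: 'a::rc_field) = - conjug x"
  using conjug_add[of x "- x"] conjug_of_real[of 0, where 'a = 'a]
  by (simp add: eq_neg_iff_add_eq_0 add.commute)

lemma add_conjug_real: "(x :: 'a::rc_field) + conjug x \<in> \<real>"
proof -
  have c1: "conjug (1::'a) = 1" using conjug_of_real[of 1, where 'a = 'a] by simp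
  have "x + conjug x = (x + 1) * conjug (x + 1) - x * conjug x - 1"
    by (simp add: conjug_add c1 algebra_simps)
  also have "\<dots> \<in> \<real>" unfolding mult_conjug by simp
  finally show ?thesis .
qed

lemma conjug_fixed_real:
  assumes "conjug (x :: 'a::rc_field) = x" shows "x \<in> \<real>"
proof -
  have "x = (x + conjug x) / 2" using assms by simp
  then show ?thesis using add_conjug_real[of x] by (metis Reals_divide Reals_numeral)
qed

lemma rc_field_cases:
  shows "(\<forall>x::'k::rc_field. \<exists>a. x = of_real a \<and> conjug x = x) \<or>
    (\<exists>j::'k::rc_field. j * j = -1 \<and> (\<forall>x. \<exists>!(a, b). x = of_real a + of_real b * j) \<and>
      (\<forall>a b. conjug (of_real a + of_real b * j) = of_real a - of_real b * j \<and>
             norm (of_real a + of_real b * j) = sqrt (a\<^sup>2 + b\<^sup>2)))"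
proof (cases "\<forall>x::'k. x \<in> \<real>")
  case True
  then show ?thesis by (metis Reals_cases conjug_of_real)
next
  case False
  then obtain x :: 'k where x: "x \<notin> \<real>" by blast
  have im: "\<exists>a w. z = of_real a + w \<and> conjug w = - w" for z :: 'k
  proof -
    obtain s where s: "z + conjug z = of_real s" using add_conjug_real[of z] by (auto elim: Reals_cases)
    have *: "conjug z = of_real s - z" using s by (simp add: algebra_simps)
    have "conjug (z - of_real (s/2)) = conjug z - of_real (s/2)"
      using conjug_add[of z "- of_real (s/2)"] by (simp only: conjug_minus conjug_of_real diff_conv_add_uminus)
    also have "\<dots> = - (z - of_real (s/2))" unfolding * by (simp add: field_simps)
    finally show ?thesis by (intro exI[of _ "s/2"] exI[of _ "z - of_real (s/2)"]) simp
  qed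
  obtain a0 y where y: "x = of_real a0 + y" "conjug y = - y" using im by blast
  have y0: "y \<noteq> 0" using x y by auto
  define j where "j = y / of_real (norm y)"
  have yj: "y = of_real (norm y) * j" using y0 by (simp add: j_def)
  have cj: "conjug j = - j"
  proof -
    have "of_real (norm y) * conjug j = of_real (norm y) * (- j)"
      using y(2) yj conjug_mult[of "of_real (norm y)" j] by (simp add: conjug_of_real)
    moreover have "(of_real (norm y) :: 'k) \<noteq> 0" using y0 by simp
    ultimately show ?thesis using mult_left_cancel by blast
  qed
  have nj: "norm j = 1" using y0 by (simp add: j_def norm_divide)
  have jj: "j * j = -1" using mult_conjug[of j] cj nj by (simp add: minus_equation_iff)
  have cab: "conjug (of_real a + of_real b * j) = of_real a - of_real b * j" for a b
    by (simp add: conjug_add conjug_mult conjug_of_real cj)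
  have nab: "norm (of_real a + of_real b * j) = sqrt (a\<^sup>2 + b\<^sup>2)" for a b
  proof -
    have "(of_real ((norm (of_real a + of_real b * j))\<^sup>2) :: 'k)
        = (of_real a + of_real b * j) * (of_real a - of_real b * j)"
      unfolding mult_conjug[symmetric] cab ..
    also have "\<dots> = of_real a * of_real a - of_real b * of_real b * (j * j)"
      by (simp add: algebra_simps)
    also have "\<dots> = of_real (a\<^sup>2 + b\<^sup>2)" unfolding jj by (simp add: power2_eq_square)
    finally have "(norm (of_real a + of_real b * j))\<^sup>2 = a\<^sup>2 + b\<^sup>2" by (simp only: of_real_eq_iff)
    then show ?thesis by (metis norm_ge_zero real_sqrt_unique)
  qed
  have ex: "\<exists>a b. z = of_real a + of_real b * j" for z
  proof -
    obtain a w where w: "z = of_real a + w" "conjug w = - w" using im by blast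
    have "conjug (w * j) = w * j" by (simp add: conjug_mult w cj)
    then obtain b where "w * j = of_real b" using conjug_fixed_real by (auto elim: Reals_cases)
    then have "w * (j * j) = of_real b * j" by (simp add: mult.assoc[symmetric])
    then have "w = of_real (- b) * j" unfolding jj
      by (simp, metis minus_minus)
    with w show ?thesis by blast
  qed
  have uniq: "a = a' \<and> b = b'" if "of_real a + of_real b * j = of_real a' + of_real b' * j" for a b a' b'
  proof -
    have "of_real (a - a') + of_real (b - b') * j = 0" using that by (simp add: algebra_simps)
    then have "sqrt ((a - a')\<^sup>2 + (b - b')\<^sup>2) = 0" using nab[of "a - a'" "b - b'"] by simp
    then show ?thesis by (simp add: sum_power2_eq_zero_iff)
  qed
  have "\<exists>!(a, b). z = of_real a + of_real b * j" for z
  proof -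
    obtain a b where ab: "z = of_real a + of_real b * j" using ex by blast
    show ?thesis
    proof (rule ex1I[of _ "(a, b)"])
      show "case (a, b) of (a, b) \<Rightarrow> z = of_real a + of_real b * j" using ab by simp
      show "p = (a, b)" if "case p of (a, b) \<Rightarrow> z = of_real a + of_real b * j" for p
        using that uniq ab by (cases p) auto
    qed
  qed
  then show ?thesis using jj cab nab by blast
qed

text \<open>
  A Hilbert space over \<open>'k\<close>. The norm, topology and completeness of \<open>'h\<close> are those of the
  library class \<open>banach\<close>; \<open>scale_of_real\<close> makes the real vector space underlying that class the
  restriction of scalars of the given one, and \<open>ip_self\<close> says that
  \<open>\<langle>x,x\<rangle>\<close> is real, nonnegative, zero only for \<open>x = 0\<close>, with square root the norm.
\<close>

locale hilbert_space = vector_space scale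
  for scale :: "'k::rc_field \<Rightarrow> 'h::banach \<Rightarrow> 'h" +
  fixes ip :: "'h \<Rightarrow> 'h \<Rightarrow> 'k"
  assumes scale_of_real: "scale (of_real r) x = r *\<^sub>R x"
    and ip_add_left: "ip (x + y) z = ip x z + ip y z"
    and ip_scale_left: "ip (scale c x) y = c * ip x y"
    and ip_commute: "ip y x = conjug (ip x y)"
    and ip_self: "ip x x = of_real ((norm x)\<^sup>2)"

definition orthonormal :: "('h::real_normed_vector \<Rightarrow> 'h \<Rightarrow> 'k::zero) \<Rightarrow> (nat \<Rightarrow> 'h) \<Rightarrow> bool"
  where "orthonormal ip e \<longleftrightarrow>
    (\<forall>i j. i \<noteq> j \<longrightarrow> ip (e i) (e j) = 0) \<and> (\<forall>i. norm (e i) = 1)"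

definition ell2 :: "(nat \<Rightarrow> 'k::real_normed_vector) set"
  where "ell2 = {a. summable (\<lambda>i. (norm (a i))\<^sup>2)}"

end

theory Submission imports Defs begin

text \<open>
  Let \<open>P\<close> be the orthogonal projection onto the closed span of the \<open>e i\<close>. The left-hand side is
  \<open>\<bar>\<langle>x - P x, y - P y\<rangle>\<bar> \<le> \<parallel>x - P x\<parallel> \<parallel>y - P y\<parallel>\<close>. Writing \<open>L\<close> for the norm of
  \<open>l = \<Sum>i. \<lambda>\<^sub>i e\<^sub>i\<close>, Pythagoras gives
  \<open>\<parallel>x\<parallel>\<^sup>2 - \<parallel>P x\<parallel>\<^sup>2 + (\<parallel>P x\<parallel> - L)\<^sup>2 \<le> \<parallel>x - l\<parallel>\<^sup>2 \<le> r\<^sup>2\<close>, whence by AM-GM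
  \<open>2 L (\<parallel>x\<parallel> - \<parallel>P x\<parallel>) \<le> r\<^sup>2\<close>; multiplying by \<open>\<parallel>x\<parallel> + \<parallel>P x\<parallel>\<close> bounds \<open>\<parallel>x - P x\<parallel>\<^sup>2\<close>.
\<close>

section \<open>Inner product geometry over \<open>'k\<close>\<close>

lemma norm_conjug: "norm (conjug x) = norm (x :: 'a::rc_field)"
proof -
  \<comment> \<open>Both sides come from the product \<open>x * conjug x\<close>, since conjugating
    it only swaps the factors.\<close>
  have "(of_real ((norm (conjug x))\<^sup>2) :: 'a) = of_real ((norm x)\<^sup>2)"
    unfolding mult_conjug[symmetric] conjug_conjug by (simp add: mult.commute)
  then have "(norm (conjug x))\<^sup>2 = (norm x)\<^sup>2"
    by (simp only: of_real_eq_iff)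
  then show ?thesis by simp
qed

context hilbert_space
begin

lemma ip_add_right: "ip x (y + z) = ip x y + ip x z"
  by (metis ip_commute ip_add_left conjug_add)

lemma ip_scale_right: "ip x (scale c y) = conjug c * ip x y"
  by (metis ip_commute ip_scale_left conjug_mult)

lemma ip_scaleR_left: "ip (r *\<^sub>R x) y = r *\<^sub>R ip x y"
  unfolding scale_of_real[symmetric] ip_scale_left by (simp add: scaleR_conv_of_real)

lemma ip_scaleR_right: "ip x (r *\<^sub>R y) = r *\<^sub>R ip x y"
  unfolding scale_of_real[symmetric] ip_scale_right by (simp add: conjug_of_real scaleR_conv_of_real)

lemma ip_eq_0_commute: "ip x y = 0 \<Longrightarrow> ip y x = 0"
  using ip_commute[of y x] norm_conjug[of "ip x y"] by simp

text \<open>The class \<open>banach\<close> gives homogeneity for real scalars only; for scalars in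
  \<open>'k\<close> it comes from \<open>ip_self\<close>.\<close>

lemma norm_scale: "norm (scale c x) = norm c * norm x"
proof -
  have "(of_real ((norm (scale c x))\<^sup>2) :: 'k) = (c * conjug c) * ip x x"
    unfolding ip_self[symmetric] by (simp add: ip_scale_left ip_scale_right)
  also have "\<dots> = of_real ((norm c * norm x)\<^sup>2)"
    by (simp add: mult_conjug ip_self power_mult_distrib)
  finally have "(norm (scale c x))\<^sup>2 = (norm c * norm x)\<^sup>2"
    by (simp only: of_real_eq_iff)
  then show ?thesis by simp
qed

lemma pythagoras:
  assumes "ip x y = 0"
  shows "(norm (x + y))\<^sup>2 = (norm x)\<^sup>2 + (norm y)\<^sup>2"
proof -
  have "ip (x + y) (x + y) = ip x x + ip y y"
    using assms ip_eq_0_commute[OF assms] by (simp add: ip_add_left ip_add_right)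
  then have "(of_real ((norm (x + y))\<^sup>2) :: 'k) = of_real ((norm x)\<^sup>2 + (norm y)\<^sup>2)"
    by (simp add: ip_self)
  then show ?thesis by (simp only: of_real_eq_iff)
qed

lemma cauchy_schwarz: "norm (ip x y) \<le> norm x * norm y"
proof (cases "y = 0")
  case True
  then show ?thesis using ip_scaleR_right[of x 0 0] by simp
next
  case False
  \<comment> \<open>This \<open>c\<close> makes \<open>scale c y\<close> the orthogonal projection
    of \<open>x\<close> onto the line through \<open>y\<close>, so its norm is at most that of
    \<open>x\<close>.\<close>
  define c where "c = ip x y / of_real ((norm y)\<^sup>2)"
  define z where "z = x + scale (- c) y"
  have "ip z y = ip x y - c * ip y y"
    by (simp only: z_def ip_add_left ip_scale_left) simp
  also have "\<dots> = 0"
    using False by (simp add: c_def ip_self)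
  finally have "ip z (scale c y) = 0" by (simp add: ip_scale_right)
  moreover have "z + scale c y = x"
    by (simp add: z_def)
  ultimately have "(norm (scale c y))\<^sup>2 \<le> (norm x)\<^sup>2"
    using pythagoras[of z "scale c y"] by simp
  then have "norm c * norm y \<le> norm x"
    by (simp add: norm_scale power2_le_iff_abs_le)
  then show ?thesis
    using False by (simp add: c_def norm_divide norm_mult power2_eq_square field_simps)
qed

text \<open>Continuity in each argument lets inner products be taken term by term in convergent
  series.\<close>

sublocale ip: bounded_bilinear ip
proof
  show "\<exists>K. \<forall>a b. norm (ip a b) \<le> norm a * norm b * K"
    using cauchy_schwarz by (intro exI[of _ 1]) simp
qed (fact ip_add_left ip_add_right ip_scaleR_left ip_scaleR_right)+

section \<open>Orthonormal series and Bessel's inequality\<close>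

lemma orthonormal_ip:
  assumes "orthonormal ip e"
  shows "ip (e i) (e j) = (if i = j then 1 else 0)"
  using assms by (auto simp: orthonormal_def ip_self)

lemma ip_sum_orthonormal:
  assumes "orthonormal ip e" "finite A"
  shows "ip (\<Sum>i\<in>A. scale (a i) (e i)) (e j) = (if j \<in> A then a j else 0)"
  using assms by (simp add: ip.sum_left ip_scale_left orthonormal_ip if_distrib cong: if_cong)

lemma norm_sum_orthonormal:
  assumes "orthonormal ip e" "finite A"
  shows "(norm (\<Sum>i\<in>A. scale (a i) (e i)))\<^sup>2 = (\<Sum>i\<in>A. (norm (a i))\<^sup>2)"
  using assms(2)
proof induction
  case (insert k A)
  have "ip (\<Sum>i\<in>A. scale (a i) (e i)) (scale (a k) (e k)) = 0"
    using insert by (simp add: ip_scale_right ip_sum_orthonormal[OF assms(1)])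
  from pythagoras[OF this] insert assms(1) show ?case
    by (simp add: norm_scale orthonormal_def add.commute)
qed simp

text \<open>Blocks of the series have as squared norm the matching blocks of the scalar series, so
  the Cauchy criterion transfers, with tolerance \<open>\<epsilon>\<^sup>2\<close> for
  \<open>\<epsilon>\<close>. Completeness of \<open>'h\<close> enters here.\<close>

lemma summable_orthonormal:
  assumes "orthonormal ip e" "summable (\<lambda>i. (norm (a i))\<^sup>2)"
  shows "summable (\<lambda>i. scale (a i) (e i))"
  unfolding summable_Cauchy
proof (intro allI impI)
  fix \<epsilon> :: real assume "\<epsilon> > 0"
  then obtain N where N: "\<And>m n. m \<ge> N \<Longrightarrow> norm (\<Sum>i=m..<n. (norm (a i))\<^sup>2) < \<epsilon>\<^sup>2"
    using assms(2) unfolding summable_Cauchy by (meson zero_less_power)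
  have "norm (\<Sum>i=m..<n. scale (a i) (e i)) < \<epsilon>" if "m \<ge> N" for m n
  proof -
    have "(norm (\<Sum>i=m..<n. scale (a i) (e i)))\<^sup>2 < \<epsilon>\<^sup>2"
      using N[OF that, of n] by (simp add: norm_sum_orthonormal[OF assms(1)])
    then show ?thesis using \<open>\<epsilon> > 0\<close> by (simp add: power_less_imp_less_base)
  qed
  then show "\<exists>N. \<forall>m\<ge>N. \<forall>n. norm (\<Sum>i=m..<n. scale (a i) (e i)) < \<epsilon>" by blast
qed

lemma norm_suminf_orthonormal:
  assumes "orthonormal ip e" "summable (\<lambda>i. (norm (a i))\<^sup>2)"
  shows "(norm (\<Sum>i. scale (a i) (e i)))\<^sup>2 = (\<Sum>i. (norm (a i))\<^sup>2)"
proof -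
  have "(\<lambda>n. (norm (\<Sum>i<n. scale (a i) (e i)))\<^sup>2) \<longlonglongrightarrow> (norm (\<Sum>i. scale (a i) (e i)))\<^sup>2"
    by (intro tendsto_intros summable_LIMSEQ summable_orthonormal assms)
  then have "(\<lambda>i. (norm (a i))\<^sup>2) sums (norm (\<Sum>i. scale (a i) (e i)))\<^sup>2"
    by (simp add: norm_sum_orthonormal[OF assms(1)] sums_def)
  then show ?thesis by (simp add: sums_iff)
qed

lemma ip_suminf_orthonormal:
  assumes "orthonormal ip e" "summable (\<lambda>i. (norm (a i))\<^sup>2)"
  shows "ip (\<Sum>i. scale (a i) (e i)) (e j) = a j"
proof -
  have "ip (\<Sum>i. scale (a i) (e i)) (e j) = (\<Sum>i. ip (scale (a i) (e i)) (e j))"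
    by (intro bounded_linear.suminf[OF ip.bounded_linear_left] summable_orthonormal assms)
  also have "\<dots> = (\<Sum>i. if i = j then a i else 0)"
    by (simp add: ip_scale_left orthonormal_ip[OF assms(1)] if_distrib cong: if_cong)
  also have "\<dots> = a j"
    using sums_single[of j a] by (simp add: sums_iff)
  finally show ?thesis .
qed

text \<open>Each partial sum is the squared norm of a finite projection \<open>p\<close> of
  \<open>x\<close>, hence at most that of \<open>x\<close>. This makes the series defining
  \<open>proj\<close> converge.\<close>

lemma summable_bessel:
  assumes "orthonormal ip e"
  shows "summable (\<lambda>i. (norm (ip x (e i)))\<^sup>2)"
proof (rule summableI_nonneg_bounded)
  fix n
  define p where "p = (\<Sum>i<n. scale (ip x (e i)) (e i))"
  have "ip (x - p) (e j) = 0" if "j < n" for j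
    using that by (simp add: p_def ip.diff_left ip_sum_orthonormal[OF assms])
  \<comment> \<open>Only the second \<open>p\<close> is expanded, into multiples of the
    \<open>e j\<close>, each orthogonal to \<open>x - p\<close>.\<close>
  then have "ip (x - p) p = 0"
    by (subst (2) p_def) (simp add: ip.sum_right ip_scale_right)
  from pythagoras[OF this] have "(norm p)\<^sup>2 \<le> (norm x)\<^sup>2" by simp
  then show "(\<Sum>i<n. (norm (ip x (e i)))\<^sup>2) \<le> (norm x)\<^sup>2"
    by (simp add: p_def norm_sum_orthonormal[OF assms])
qed simp

section \<open>Projection onto the closed span of the \<open>e i\<close>\<close>

definition proj :: "(nat \<Rightarrow> 'h) \<Rightarrow> 'h \<Rightarrow> 'h"
  where "proj e x = (\<Sum>i. scale (ip x (e i)) (e i))"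

lemma norm_proj:
  assumes "orthonormal ip e"
  shows "norm (proj e x) = sqrt (\<Sum>i. (norm (ip x (e i)))\<^sup>2)"
  unfolding proj_def norm_suminf_orthonormal[OF assms summable_bessel[OF assms], symmetric] by simp

lemma ip_proj_left:
  assumes "orthonormal ip e"
  shows "ip (proj e x) y = (\<Sum>i. ip x (e i) * ip (e i) y)"
  unfolding proj_def
  by (subst bounded_linear.suminf[OF ip.bounded_linear_left])
    (simp_all add: ip_scale_left summable_orthonormal summable_bessel assms)

text \<open>\<open>x\<close> and \<open>proj e x\<close> have the same coefficients, so the residual
  is orthogonal to each \<open>e j\<close> and, by continuity, to the series. The coefficients are
  arbitrary so as to cover both projections and given \<open>ell2\<close> approximations.\<close>

lemma proj_residual_orthogonal:
  assumes "orthonormal ip e" "summable (\<lambda>i. (norm (a i))\<^sup>2)"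
  shows "ip (x - proj e x) (\<Sum>i. scale (a i) (e i)) = 0"
proof -
  have "ip (x - proj e x) (e j) = 0" for j
    using ip_suminf_orthonormal[OF assms(1) summable_bessel[OF assms(1)]]
    by (simp add: ip.diff_left proj_def)
  then show ?thesis
    by (subst bounded_linear.suminf[OF ip.bounded_linear_right])
      (simp_all add: ip_scale_right summable_orthonormal assms)
qed

lemma norm_proj_residual:
  assumes "orthonormal ip e"
  shows "(norm (x - proj e x))\<^sup>2 = (norm x)\<^sup>2 - (norm (proj e x))\<^sup>2"
  using pythagoras[of "x - proj e x" "proj e x"]
    proj_residual_orthogonal[OF assms summable_bessel[OF assms], of x x, folded proj_def]
  by simp

lemma norm_proj_le:
  assumes "orthonormal ip e"
  shows "norm (proj e x) \<le> norm x"
proof -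
  have "(norm (proj e x))\<^sup>2 \<le> (norm x)\<^sup>2"
    using norm_proj_residual[OF assms, of x] zero_le_power2[of "norm (x - proj e x)"] by linarith
  then show ?thesis by simp
qed

lemma norm_ip_diff_suminf_le:
  assumes "orthonormal ip e"
  shows "norm (ip x y - (\<Sum>i. ip x (e i) * ip (e i) y))
    \<le> norm (x - proj e x) * norm (y - proj e y)"
proof -
  \<comment> \<open>The residual of \<open>x\<close> is orthogonal to \<open>proj e y\<close>, so
    the right side equals \<open>ip (x - proj e x) y\<close>; the series is
    \<open>ip (proj e x) y\<close>.\<close>
  have "ip x y - (\<Sum>i. ip x (e i) * ip (e i) y) = ip (x - proj e x) (y - proj e y)"
    using proj_residual_orthogonal[OF assms summable_bessel[OF assms], of x y, folded proj_def]
    by (simp add: ip_proj_left[OF assms, symmetric] ip.diff_left ip.diff_right)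
  then show ?thesis using cauchy_schwarz by simp
qed

section \<open>Residual bound from an approximation in the closed span\<close>

lemma norm_proj_residual_le:
  assumes on: "orthonormal ip e" and a: "a \<in> ell2" "a \<noteq> (\<lambda>_. 0)"
    and r: "r > 0" "norm (x - (\<Sum>i. scale (a i) (e i))) \<le> r"
  shows "norm (x - proj e x)
    \<le> r * sqrt (norm x + norm (proj e x)) / (sqrt 2 * root 4 (\<Sum>i. (norm (a i))\<^sup>2))"
proof -
  define l where "l = (\<Sum>i. scale (a i) (e i))"
  define L where "L = norm l"
  define p where "p = norm (proj e x)"
  have sum_a: "summable (\<lambda>i. (norm (a i))\<^sup>2)"
    using a by (simp add: ell2_def)
  have L2: "L\<^sup>2 = (\<Sum>i. (norm (a i))\<^sup>2)"
    by (simp add: L_def l_def norm_suminf_orthonormal[OF on sum_a])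
  \<comment> \<open>A nonzero coefficient makes \<open>L\<close> positive, which the later division
    by \<open>L\<close> requires.\<close>
  obtain k where "a k \<noteq> 0" using a(2) by auto
  then have "L\<^sup>2 > 0"
    unfolding L2 by (intro suminf_pos2[where i = k] sum_a) auto
  then have L: "L > 0" by (simp add: L_def)
  have "root 4 (L\<^sup>2) = sqrt (sqrt (L\<^sup>2))"
    using real_root_mult_exp[of 2 2 "L\<^sup>2"] by (simp add: sqrt_def)
  then have root4: "root 4 (\<Sum>i. (norm (a i))\<^sup>2) = sqrt L"
    using L unfolding L2[symmetric] by simp
  \<comment> \<open>Both \<open>proj e x\<close> and \<open>l\<close> are series in the
    \<open>e i\<close>, so \<open>x - l\<close> splits orthogonally at
    \<open>proj e x\<close>.\<close>
  have "ip (x - proj e x) (proj e x - l) = 0"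
    using proj_residual_orthogonal[OF on summable_bessel[OF on], of x x, folded proj_def]
      proj_residual_orthogonal[OF on sum_a, of x]
    by (simp add: ip.diff_right l_def)
  from pythagoras[OF this]
  have "(norm x)\<^sup>2 - p\<^sup>2 + (norm (proj e x - l))\<^sup>2 = (norm (x - l))\<^sup>2"
    by (simp add: norm_proj_residual[OF on] p_def)
  moreover have "(norm (x - l))\<^sup>2 \<le> r\<^sup>2"
    using r by (intro power_mono) (simp_all add: l_def)
  moreover have "(p - L)\<^sup>2 \<le> (norm (proj e x - l))\<^sup>2"
    using norm_triangle_ineq3[of "proj e x" l] by (simp add: p_def L_def flip: abs_le_square_iff)
  ultimately have "(norm x)\<^sup>2 - p\<^sup>2 + (p - L)\<^sup>2 \<le> r\<^sup>2" by linarith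
  \<comment> \<open>The left side of the previous bound equals
    \<open>(norm x - L)\<^sup>2 + 2 * L * (norm x - p)\<close>.\<close>
  then have "2 * L * (norm x - p) \<le> r\<^sup>2"
    using zero_le_power2[of "norm x - L"] by (simp add: power2_eq_square algebra_simps)
  then have "2 * L * (norm x - p) * (norm x + p) \<le> r\<^sup>2 * (norm x + p)"
    by (intro mult_right_mono) (simp_all add: p_def)
  then have "2 * L * (norm (x - proj e x))\<^sup>2 \<le> r\<^sup>2 * (norm x + p)"
    unfolding norm_proj_residual[OF on] p_def[symmetric] by (simp add: power2_eq_square algebra_simps)
  then have "(norm (x - proj e x))\<^sup>2 \<le> r\<^sup>2 * (norm x + p) / (2 * L)"
    using L by (simp add: field_simps)
  then have "norm (x - proj e x) \<le> sqrt (r\<^sup>2 * (norm x + p) / (2 * L))"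
    by (rule real_le_rsqrt)
  also have "\<dots> = r * sqrt (norm x + p) / (sqrt 2 * sqrt L)"
    using r by (simp add: real_sqrt_mult real_sqrt_divide)
  finally show ?thesis unfolding root4 p_def .
qed

end

theorem theorem9:
  fixes scale :: "'k::rc_field \<Rightarrow> 'h::banach \<Rightarrow> 'h"
    and ip :: "'h \<Rightarrow> 'h \<Rightarrow> 'k"
    and e :: "nat \<Rightarrow> 'h"
    and lam mu :: "nat \<Rightarrow> 'k"
    and r1 r2 :: real
    and x y :: 'h
  assumes "hilbert_space scale ip"
    and "\<nexists>B. finite_dimensional_vector_space scale B"
    and "orthonormal ip e"
    and "lam \<in> ell2" and "mu \<in> ell2"
    and "lam \<noteq> (\<lambda>_. 0)" and "mu \<noteq> (\<lambda>_. 0)"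
    and "r1 > 0" and "r2 > 0"
    and "norm (x - (\<Sum>i. scale (lam i) (e i))) \<le> r1"
    and "norm (y - (\<Sum>i. scale (mu i) (e i))) \<le> r2"
  shows "norm (ip x y - (\<Sum>i. ip x (e i) * ip (e i) y))
      \<le> 1 / 2 * r1 * r2 *
        (sqrt (norm x + sqrt (\<Sum>i. (norm (ip x (e i)))\<^sup>2)) *
         sqrt (norm y + sqrt (\<Sum>i. (norm (ip y (e i)))\<^sup>2)))
        / (root 4 (\<Sum>i. (norm (lam i))\<^sup>2) * root 4 (\<Sum>i. (norm (mu i))\<^sup>2))
    \<and> 1 / 2 * r1 * r2 *
        (sqrt (norm x + sqrt (\<Sum>i. (norm (ip x (e i)))\<^sup>2)) *
         sqrt (norm y + sqrt (\<Sum>i. (norm (ip y (e i)))\<^sup>2)))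
        / (root 4 (\<Sum>i. (norm (lam i))\<^sup>2) * root 4 (\<Sum>i. (norm (mu i))\<^sup>2))
      \<le> r1 * r2 * (sqrt (norm x) * sqrt (norm y))
        / (root 4 (\<Sum>i. (norm (lam i))\<^sup>2) * root 4 (\<Sum>i. (norm (mu i))\<^sup>2))"
proof -
  interpret hilbert_space scale ip by fact
  note on = \<open>orthonormal ip e\<close>
  define X where "X = norm x + norm (proj e x)"
  define Y where "Y = norm y + norm (proj e y)"
  define R where "R = root 4 (\<Sum>i. (norm (lam i))\<^sup>2) * root 4 (\<Sum>i. (norm (mu i))\<^sup>2)"
  have R: "R \<ge> 0"
    using assms(4,5) by (auto simp: R_def ell2_def intro!: mult_nonneg_nonneg real_root_ge_zero suminf_nonneg)
  have XY: "X \<ge> 0" "Y \<ge> 0"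
    by (simp_all add: X_def Y_def)
  have "norm (ip x y - (\<Sum>i. ip x (e i) * ip (e i) y))
      \<le> norm (x - proj e x) * norm (y - proj e y)"
    by (rule norm_ip_diff_suminf_le[OF on])
  also have "\<dots> \<le> (r1 * sqrt X / (sqrt 2 * root 4 (\<Sum>i. (norm (lam i))\<^sup>2)))
      * (r2 * sqrt Y / (sqrt 2 * root 4 (\<Sum>i. (norm (mu i))\<^sup>2)))"
    unfolding X_def Y_def using assms
    by (intro mult_mono' norm_proj_residual_le) auto
  \<comment> \<open>The two factors \<open>sqrt 2\<close> in the denominators produce the constant
    \<open>1 / 2\<close>.\<close>
  also have "\<dots> = 1 / 2 * r1 * r2 * (sqrt X * sqrt Y) / R"
    by (simp add: R_def field_simps)
  finally have *: "norm (ip x y - (\<Sum>i. ip x (e i) * ip (e i) y))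
      \<le> 1 / 2 * r1 * r2 * (sqrt X * sqrt Y) / R" .
  \<comment> \<open>For the second inequality, \<open>norm_proj_le\<close> gives
    \<open>X \<le> 2 * norm x\<close> and likewise for \<open>Y\<close>; the resulting factor 2
    cancels \<open>1 / 2\<close>.\<close>
  have "sqrt X * sqrt Y \<le> sqrt (2 * norm x) * sqrt (2 * norm y)"
    using norm_proj_le[OF on] XY by (intro mult_mono) (simp_all add: X_def Y_def)
  also have "\<dots> = 2 * (sqrt (norm x) * sqrt (norm y))"
    by (simp add: real_sqrt_mult)
  finally have "r1 * r2 / 2 * (sqrt X * sqrt Y) \<le> r1 * r2 / 2 * (2 * (sqrt (norm x) * sqrt (norm y)))"
    using \<open>r1 > 0\<close> \<open>r2 > 0\<close> by (intro mult_left_mono) auto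
  then have "1 / 2 * r1 * r2 * (sqrt X * sqrt Y) / R \<le> r1 * r2 * (sqrt (norm x) * sqrt (norm y)) / R"
    using R by (intro divide_right_mono) simp_all
  \<comment> \<open>\<open>norm_proj\<close> turns the projection norms in \<open>X\<close> and
    \<open>Y\<close> into the square roots of the coefficient sums.\<close>
  with * show ?thesis
    unfolding X_def Y_def R_def norm_proj[OF on] by blast
qed

end
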